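(* Let $L=M\left(\left.\frac{p_1}{q_1},\frac{p_2}{q_2},\cdots,\frac{p_n}{q_n}\right| e\right)$ be a 2-component Montesinos link, with $p_i,q_i$ relatively prime integers for each $i$ and $e$ an integer. If none of the rational tangles of $L$ is an $H$-tangle, then the linking number of $L$ is $$lk(L) = \pm\left(\sum_{k=1}^n lk\big(R_{(q_k+e_kp_k)/p_k}\big)+\frac12\Big(e-\sum_{k=1}^n e_k\Big)\right),$$ where $e_i=\frac{1-(-1)^{q_i}}{2}$ for each $i$, $R_{p/q}$ denotes the oriented rational $\frac pq$-link, and the overall sign $\pm$ depends on the orientations of the components of $L$.
   Context: Linking number: for an oriented link diagram, a crossing between two different components is positive if the overstrand passes the understrand from left to right (as seen when travelling along the oriented understrand), and negative otherwise. The linking number of two components is half the sum of the signs of the crossings between them; for a two-component link $L$, $lk(L)$ is the linking number of its two components. Rational tangles: a 2-tangle is a proper embedding of two disjoint arcs in a 3-ball whose four endpoints lie on the boundary sphere and are labelled NW, NE, SW, SE. Let $T_0$ be the 2-tangle made of two horizontal arcs without crossings (joining NW to NE and SW to SE); its fraction is $0/1$. A rational tangle is a 2-tangle obtained from $T_0$ by horizontal and vertical twists. Let $[+1]$ be the one-crossing tangle whose overstrand has positive slope (runs from SW to NE), and $[-1]$ the one whose overstrand has negative slope. Adding a positive (resp. negative) horizontal twist means placing $[+1]$ (resp. $[-1]$) to the right of the tangle and joining adjacent endpoints; it changes the fraction $F$ to $F+1$ (resp. $F-1$). Adding a positive (resp. negative) vertical twist means placing $[+1]$ (resp. $[-1]$)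 below the tangle and joining adjacent endpoints; it changes the fraction $F$ so that $1/F$ becomes $1/F+1$ (resp. $1/F-1$), with $1/0=\infty$ and $1/\infty=0$. By Conway's theorem two rational tangles are equivalent (isotopic fixing the endpoints) if and only if their fractions are equal. A rational $\frac pq$-tangle ($p,q$ relatively prime) is a rational tangle with fraction $\frac pq$. Types: a rational tangle is a $V$-, $D$- or $H$-tangle if the strand starting at NW ends at SW, SE or NE, respectively. A $\frac pq$-tangle is a $V$-tangle iff $p$ is odd and $q$ is even, a $D$-tangle iff $p$ and $q$ are both odd, and an $H$-tangle iff $p$ is even and $q$ is odd. Rational links: the numerator closure $N(T)$ of a rational tangle $T$ is obtained by joining NW with NE and SW with SE by arcs outside the ball, without crossings. For $p$ even and $T$ a rational $\frac pq$-tangle, $N(T)$ has two components, and $R_{p/q}$ is the oriented link $N(T)$ in which the strand with endpoints NE, NW is oriented from NE to NW and the other strand is oriented from SW to SE; $lk(R_{p/q})$ is the linking number of its two components. Montesinos links: $M\left(\left.\frac{p_1}{q_1},\dots,\frac{p_n}{q_n}\right| e\right)$ is the link formed by stacking vertically, from top to bottom, rational $\frac{p_i}{q_i}$-tangles $T_1,\dots,T_n$ and then $e$ half twists, each one's SW and SE endpoints being joined to the NW and NE endpoints, respectively, of the next one, and finally joining the SW and SE endpoints of the bottom piece to the NW and NE endpoints of $T_1$, respectively, by two arcs without crossings running parallel outside, so that the pieces are connected in cyclic order. The $e$ half twists are $|e|$ crossings stacked vertically, each being $[+1]$ if $e>0$ and $[-1]$ if $e<0$ (two vertical parallel strands if $e=0$).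 *)

theory Defs
  imports Complex_Main
begin

text \<open>
  Link and tangle diagrams are assembled from elementary pieces, each occupying a square whose
  four corners are the endpoints of the piece: the crossingless pieces \<open>[0]\<close> (two horizontal arcs)
  and \<open>[\<infinity>]\<close> (two vertical arcs), and the crossings \<open>[+1]\<close>, \<open>[-1]\<close>, whose overstrand has positive,
  respectively negative, slope.  Endpoint \<open>(i, c)\<close> is corner \<open>c\<close> of the \<open>i\<close>-th piece.
  Endpoints are joined in pairs by crossingless arcs.  Every endpoint of a link diagram is joined
  to exactly one other; in a tangle diagram exactly four are left free, and \<open>ends\<close> labels these.
  Only the incidences of the joining arcs are recorded, since their position in the plane does not
  enter into components, orientations or crossing signs.
\<close>

datatype corner = NW | NE | SW | SE

datatype piece = Zero | Infty | PlusOne | MinusOne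

type_synonym endpoint = "nat \<times> corner"

record diagram =
  pieces :: "piece list"
  joins :: "(endpoint \<times> endpoint) set"

record tangle = diagram +
  ends :: "corner \<Rightarrow> endpoint"

fun other_end :: "piece \<Rightarrow> corner \<Rightarrow> corner" where
  "other_end Zero NW = NE" | "other_end Zero NE = NW"
| "other_end Zero SW = SE" | "other_end Zero SE = SW"
| "other_end Infty NW = SW" | "other_end Infty SW = NW"
| "other_end Infty NE = SE" | "other_end Infty SE = NE"
| "other_end _ NW = SE" | "other_end _ SE = NW"
| "other_end _ NE = SW" | "other_end _ SW = NE"

definition endpoints :: "'a diagram_scheme \<Rightarrow> endpoint set" where
  "endpoints D = {..<length (pieces D)} \<times> UNIV"

definition arcs :: "'a diagram_scheme \<Rightarrow> (endpoint \<times> endpoint) set" where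
  "arcs D = {((i, c), (i, other_end (pieces D ! i) c)) | i c. i < length (pieces D)} \<union> joins D"

definition same_strand :: "'a diagram_scheme \<Rightarrow> (endpoint \<times> endpoint) set" where
  "same_strand D = Restr ((arcs D \<union> (arcs D)\<inverse>)\<^sup>*) (endpoints D)"

definition components :: "'a diagram_scheme \<Rightarrow> endpoint set set" where
  "components D = endpoints D // same_strand D"


text \<open>
  An orientation is given by the predicate telling at which endpoints the oriented strand leaves
  the piece (as opposed to entering it).
\<close>

definition orientation :: "'a diagram_scheme \<Rightarrow> (endpoint \<Rightarrow> bool) \<Rightarrow> bool" where
  "orientation D out \<longleftrightarrow>
     (\<forall>i<length (pieces D). \<forall>c. out (i, other_end (pieces D ! i) c) \<longleftrightarrow> \<not> out (i, c)) \<and>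
     (\<forall>(a, b)\<in>joins D. out b \<longleftrightarrow> \<not> out a)"

fun position :: "corner \<Rightarrow> int \<times> int" where
  "position NW = (-1, 1)"
| "position NE = (1, 1)"
| "position SW = (-1, -1)"
| "position SE = (1, -1)"

definition direction :: "(endpoint \<Rightarrow> bool) \<Rightarrow> nat \<Rightarrow> corner \<Rightarrow> corner \<Rightarrow> int \<times> int" where
  "direction out i c d = (if out (i, c) then position c else position d)"

definition over_direction :: "'a diagram_scheme \<Rightarrow> (endpoint \<Rightarrow> bool) \<Rightarrow> nat \<Rightarrow> int \<times> int" where
  "over_direction D out i =
     (if pieces D ! i = PlusOne then direction out i SW NE else direction out i NW SE)"

definition under_direction :: "'a diagram_scheme \<Rightarrow> (endpoint \<Rightarrow> bool) \<Rightarrow> nat \<Rightarrow> int \<times> int" where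
  "under_direction D out i =
     (if pieces D ! i = PlusOne then direction out i NW SE else direction out i SW NE)"

text \<open>The vector \<open>v\<close> points from the left to the right of \<open>u\<close> iff \<open>det (u, v) < 0\<close>.\<close>

definition left_to_right :: "int \<times> int \<Rightarrow> int \<times> int \<Rightarrow> bool" where
  "left_to_right u v \<longleftrightarrow> fst u * snd v - snd u * fst v < 0"

definition crossing_sign :: "'a diagram_scheme \<Rightarrow> (endpoint \<Rightarrow> bool) \<Rightarrow> nat \<Rightarrow> int" where
  "crossing_sign D out i =
     (if left_to_right (under_direction D out i) (over_direction D out i) then 1 else -1)"

text \<open>The two strands of a crossing contain its endpoints \<open>NW\<close> and \<open>NE\<close>, respectively.\<close>

definition crossings_between ::
  "'a diagram_scheme \<Rightarrow> endpoint set \<Rightarrow> endpoint set \<Rightarrow> nat set" where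
  "crossings_between D A B =
     {i. i < length (pieces D) \<and> pieces D ! i \<in> {PlusOne, MinusOne} \<and>
         ((i, NW) \<in> A \<and> (i, NE) \<in> B \<or> (i, NW) \<in> B \<and> (i, NE) \<in> A)}"

definition linking_number ::
  "'a diagram_scheme \<Rightarrow> (endpoint \<Rightarrow> bool) \<Rightarrow> endpoint set \<Rightarrow> endpoint set \<Rightarrow> rat" where
  "linking_number D out A B =
     (\<Sum>i\<in>crossings_between D A B. rat_of_int (crossing_sign D out i)) / 2"


definition elementary :: "piece \<Rightarrow> tangle" where
  "elementary x = \<lparr>pieces = [x], joins = {}, ends = (\<lambda>c. (0, c))\<rparr>"

definition shift :: "nat \<Rightarrow> endpoint \<Rightarrow> endpoint" where
  "shift m a = (m + fst a, snd a)"

text \<open>\<open>beside S T\<close> has \<open>T\<close> to the right of \<open>S\<close>; \<open>above S T\<close> has \<open>T\<close> below \<open>S\<close>.\<close>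

definition beside :: "tangle \<Rightarrow> tangle \<Rightarrow> tangle" where
  "beside S T =
     (let sh = shift (length (pieces S))
      in \<lparr>pieces = pieces S @ pieces T,
          joins = joins S \<union> map_prod sh sh ` joins T \<union>
            {(ends S NE, sh (ends T NW)), (ends S SE, sh (ends T SW))},
          ends = (\<lambda>c. if c \<in> {NW, SW} then ends S c else sh (ends T c))\<rparr>)"

definition above :: "tangle \<Rightarrow> tangle \<Rightarrow> tangle" where
  "above S T =
     (let sh = shift (length (pieces S))
      in \<lparr>pieces = pieces S @ pieces T,
          joins = joins S \<union> map_prod sh sh ` joins T \<union>
            {(ends S SW, sh (ends T NW)), (ends S SE, sh (ends T NE))},
          ends = (\<lambda>c. if c \<in> {NW, NE} then ends S c else sh (ends T c))\<rparr>)"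

definition numerator_closure :: "tangle \<Rightarrow> diagram" where
  "numerator_closure T =
     \<lparr>pieces = pieces T,
      joins = joins T \<union> {(ends T NW, ends T NE), (ends T SW, ends T SE)}\<rparr>"

definition vertical_closure :: "tangle \<Rightarrow> diagram" where
  "vertical_closure T =
     \<lparr>pieces = pieces T,
      joins = joins T \<union> {(ends T SW, ends T NW), (ends T SE, ends T NE)}\<rparr>"


datatype fraction = Fin rat | Inf

fun add_frac :: "fraction \<Rightarrow> rat \<Rightarrow> fraction" where
  "add_frac (Fin r) s = Fin (r + s)"
| "add_frac Inf s = Inf"

fun recip :: "fraction \<Rightarrow> fraction" where
  "recip (Fin r) = (if r = 0 then Inf else Fin (1 / r))"
| "recip Inf = Fin 0"

definition frac_of :: "int \<Rightarrow> int \<Rightarrow> fraction" where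
  "frac_of p q = (if q = 0 then Inf else Fin (of_int p / of_int q))"

inductive has_fraction :: "tangle \<Rightarrow> fraction \<Rightarrow> bool" where
  zero: "has_fraction (elementary Zero) (Fin 0)"
| horizontal_plus: "has_fraction T F \<Longrightarrow>
    has_fraction (beside T (elementary PlusOne)) (add_frac F 1)"
| horizontal_minus: "has_fraction T F \<Longrightarrow>
    has_fraction (beside T (elementary MinusOne)) (add_frac F (-1))"
| vertical_plus: "has_fraction T F \<Longrightarrow>
    has_fraction (above T (elementary PlusOne)) (recip (add_frac (recip F) 1))"
| vertical_minus: "has_fraction T F \<Longrightarrow>
    has_fraction (above T (elementary MinusOne)) (recip (add_frac (recip F) (-1)))"

definition rational_tangle :: "int \<Rightarrow> int \<Rightarrow> tangle \<Rightarrow> bool" where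
  "rational_tangle p q T \<longleftrightarrow> coprime p q \<and> has_fraction T (frac_of p q)"

definition H_tangle :: "tangle \<Rightarrow> bool" where
  "H_tangle T \<longleftrightarrow> (ends T NW, ends T NE) \<in> same_strand T"


text \<open>
  The orientation of \<open>R\<^bsub>p/q\<^esub>\<close>: one strand enters the tangle at \<open>NE\<close> and leaves it at \<open>NW\<close>, the
  other enters at \<open>SW\<close> and leaves at \<open>SE\<close>.
\<close>

definition R_orientation :: "tangle \<Rightarrow> (endpoint \<Rightarrow> bool) \<Rightarrow> bool" where
  "R_orientation T out \<longleftrightarrow> orientation (numerator_closure T) out \<and>
     \<not> out (ends T NE) \<and> out (ends T NW) \<and> \<not> out (ends T SW) \<and> out (ends T SE)"

text \<open>
  \<open>lk_R p q\<close> is only meaningful for coprime \<open>p\<close>, \<open>q\<close> with \<open>p\<close> even; then the value does not depend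
  on the choice of the rational \<open>p/q\<close>-tangle.
\<close>

definition lk_R :: "int \<Rightarrow> int \<Rightarrow> rat" where
  "lk_R p q = (THE l. \<exists>T out A B. rational_tangle p q T \<and> R_orientation T out \<and>
     components (numerator_closure T) = {A, B} \<and> A \<noteq> B \<and>
     l = linking_number (numerator_closure T) out A B)"


fun stack :: "tangle \<Rightarrow> tangle list \<Rightarrow> tangle" where
  "stack T [] = T"
| "stack T (U # Us) = stack (above T U) Us"

definition half_twists :: "int \<Rightarrow> tangle list" where
  "half_twists e =
     (if e = 0 then [elementary Infty]
      else replicate (nat \<bar>e\<bar>) (elementary (if e > 0 then PlusOne else MinusOne)))"

text \<open>Meaningful for a nonempty list of tangles.\<close>

definition montesinos :: "tangle list \<Rightarrow> int \<Rightarrow> diagram" where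
  "montesinos Ts e = vertical_closure (stack (hd Ts) (tl Ts @ half_twists e))"

end

theory Submission
  imports Defs
begin

text \<open>
  Orient both strands of a tangle in a fixed way that depends only on how its ends are connected:
  if no strand joins \<open>NW\<close> to \<open>NE\<close>, let both strands run upwards; for an \<open>H\<close>-tangle take the
  antiparallel orientation of \<open>R\<^bsub>p/q\<^esub>\<close>.  Let \<open>l\<close> be the sum of the signs of the crossings between
  the two strands.  Reversing both strands preserves \<open>l\<close>, and reversing one of them negates it.

  A twist crosses the two strands and changes \<open>l\<close> by \<open>\<plusminus>1\<close>, unless the two ends that it twists
  belong to the same strand; then the new crossing does not count, but the twisted strand arrives
  reversed, and \<open>l\<close> becomes \<open>- l\<close>.  For a rational \<open>p/q\<close>-tangle parity tells which case occurs, so a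
  horizontal twist replaces \<open>l\<close> by \<open>- l\<close> if \<open>q\<close> is even and by \<open>l \<plusminus> 1\<close> if \<open>q\<close> is odd; vertical
  twists do the same with \<open>p\<close> and \<open>q\<close> exchanged.  These rules are satisfied by a function
  \<open>frac_linking p q\<close> that is defined by the subtractive Euclidean algorithm.  Hence \<open>l\<close> depends
  on the fraction alone (\<open>has_fraction_imp_tangle_of_shape\<close>), and the linking number of \<open>R\<^bsub>p/q\<^esub>\<close> is
  \<open>frac_linking p q / 2\<close> (\<open>lk_R_eq\<close>).

  If no tangle of a Montesinos link is an \<open>H\<close>-tangle, orient all strands of all pieces upwards.
  These orientations fit together, and any other orientation of the link changes at most the sign
  of the linking number.  Since the link has two components, the two strands of each piece lie on
  different ones.  So the doubled linking number is
  \<open>\<plusminus>(e + (\<Sum>k. frac_linking (p\<^sub>k) (q\<^sub>k)))\<close>.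
  In the claimed formula, \<open>R\<close> has fraction \<open>q\<^sub>k/p\<^sub>k + e\<^sub>k\<close>; as \<open>frac_linking\<close> is symmetric and
  \<open>p\<^sub>k\<close> is odd, passing to the reciprocal changes nothing, and the \<open>e\<^sub>k\<close> added twists contribute
  \<open>e\<^sub>k\<close>, which is subtracted again.
\<close>

section \<open>Linking of the two strands as a function of the fraction\<close>

text \<open>
  The recursion undoes one horizontal twist if \<open>q \<le> p\<close>, and one vertical twist otherwise.
\<close>

fun euclid_linking :: "nat \<Rightarrow> nat \<Rightarrow> int" where
  "euclid_linking p q =
     (if p = 0 \<or> q = 0 then 0
      else if q \<le> p then if even q then - euclid_linking (p - q) q else euclid_linking (p - q) q + 1
      else if even p then - euclid_linking p (q - p) else euclid_linking p (q - p) + 1)"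

declare euclid_linking.simps [simp del]

lemma euclid_linking_commute: "euclid_linking p q = euclid_linking q p"
proof (induction p q rule: euclid_linking.induct)
  case (1 p q)
  then show ?case
    by (cases "p = q") (auto simp: euclid_linking.simps [of p q] euclid_linking.simps [of q p])
qed

lemma euclid_linking_0 [simp]: "euclid_linking 0 q = 0" "euclid_linking p 0 = 0"
  by (simp_all add: euclid_linking.simps)

lemma euclid_linking_add:
  "q > 0 \<Longrightarrow> euclid_linking (p + q) q =
     (if even q then - euclid_linking p q else euclid_linking p q + 1)"
  by (simp add: euclid_linking.simps [of "p + q" q])

text \<open>
  This is the twist rule at the point where the fraction changes its sign: adding \<open>1\<close> to
  \<open>- p/(p + r)\<close> gives \<open>r/(p + r)\<close>.  One step of the recursion reduces both sides to \<open>p/r\<close> and \<open>r/p\<close>,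
  where the symmetry applies.
\<close>

lemma euclid_linking_complement:
  assumes "p > 0" "r > 0"
  shows "euclid_linking r (p + r) =
    (if even (p + r) then euclid_linking p (p + r) else 1 - euclid_linking p (p + r))"
proof -
  have "euclid_linking p (r + p) =
      (if even p then - euclid_linking p r else euclid_linking p r + 1)"
    using euclid_linking_add [of p r] assms by (simp add: euclid_linking_commute)
  moreover have "euclid_linking r (p + r) =
      (if even r then - euclid_linking p r else euclid_linking p r + 1)"
    using euclid_linking_add [of r p] assms by (simp add: euclid_linking_commute)
  ultimately show ?thesis by (auto simp: add.commute)
qed

definition frac_linking :: "int \<Rightarrow> int \<Rightarrow> int" where
  "frac_linking p q = sgn p * sgn q * euclid_linking (nat \<bar>p\<bar>) (nat \<bar>q\<bar>)"

lemma frac_linking_commute: "frac_linking p q = frac_linking q p"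
  by (simp add: frac_linking_def euclid_linking_commute)

lemma frac_linking_uminus: "frac_linking (- p) (- q) = frac_linking p q"
  by (simp add: frac_linking_def)

lemma frac_linking_add_pos:
  assumes "q > 0"
  shows "frac_linking (p + q) q = (if even q then - frac_linking p q else frac_linking p q + 1)"
proof -
  obtain b where b: "q = int b" "b > 0"
    using assms by (metis pos_int_cases)
  \<comment> \<open>The fractions \<open>p/q\<close> and \<open>p/q + 1\<close> have opposite signs iff \<open>-1 < p/q < 0\<close>.\<close>
  consider a where "p = int a" | a where "p = - int (a + b)"
    | a r where "p = - int a" "b = a + r" "a > 0" "r > 0"
  proof (cases "p \<ge> 0")
    case True
    then show ?thesis using that(1) [of "nat p"] by simp
  next
    case False
    then show ?thesis
      using that(2) [of "nat (- p - q)"] that(3) [of "nat (- p)" "nat (p + q)"] b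
      by (cases "p + q \<le> 0") auto
  qed
  then show ?thesis
  proof cases
    case 1
    show ?thesis
    proof (cases "a = 0")
      case True
      then show ?thesis
        using b 1 euclid_linking_add [of b 0] by (simp add: frac_linking_def)
    next
      case False
      then show ?thesis
        using b 1 euclid_linking_add [of b a] by (simp add: frac_linking_def nat_add_distrib)
    qed
  next
    case 2
    show ?thesis
    proof (cases "a = 0")
      case True
      then show ?thesis
        using b 2 euclid_linking_add [of b 0] by (simp add: frac_linking_def)
    next
      case False
      then show ?thesis
        using b 2 euclid_linking_add [of b a]
        by (simp add: frac_linking_def nat_add_distrib add.commute)
    qed
  next
    case 3
    then show ?thesis
      using b euclid_linking_complement [of a r] by (simp add: frac_linking_def nat_add_distrib)
  qed
qed

lemma frac_linking_add:
  "frac_linking (p + q) q = (if even q then - frac_linking p q else frac_linking p q + 1)"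
proof (cases q "0 :: int" rule: linorder_cases)
  case less
  have "frac_linking (p + q) q = frac_linking (- p + - q) (- q)"
    using frac_linking_uminus [of "p + q" q] by (simp add: add.commute)
  also have "\<dots> = (if even q then - frac_linking p q else frac_linking p q + 1)"
    using less by (subst frac_linking_add_pos) (simp_all add: frac_linking_uminus)
  finally show ?thesis .
qed (simp_all add: frac_linking_add_pos, simp add: frac_linking_def)

lemma frac_linking_diff:
  "frac_linking (p - q) q = (if even q then - frac_linking p q else frac_linking p q - 1)"
  using frac_linking_add [of "p - q" q] by simp


section \<open>Colourings and orientations of diagrams\<close>

text \<open>
  A marking colours the strands if \<open>w\<close> is false and orients them if \<open>w\<close> is true: the value is kept,
  respectively negated, along each arc.  Both notions are propagated along strands and across
  joins by the same argument; colourings detect which endpoints lie on the same strand.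
\<close>

definition marking :: "bool \<Rightarrow> 'a diagram_scheme \<Rightarrow> (endpoint \<Rightarrow> bool) \<Rightarrow> bool" where
  "marking w D m \<longleftrightarrow>
     (\<forall>i<length (pieces D). \<forall>c. m (i, other_end (pieces D ! i) c) \<longleftrightarrow> m (i, c) \<noteq> w) \<and>
     (\<forall>(a, b)\<in>joins D. m b \<longleftrightarrow> m a \<noteq> w)"

lemma orientation_iff_marking: "orientation D out \<longleftrightarrow> marking True D out"
  by (simp add: orientation_def marking_def)

text \<open>
  If \<open>col\<close> distinguishes two components, this is twice their linking number.
\<close>

definition mixed_writhe ::
  "'a diagram_scheme \<Rightarrow> (endpoint \<Rightarrow> bool) \<Rightarrow> (endpoint \<Rightarrow> bool) \<Rightarrow> int" where
  "mixed_writhe D col out =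
     (\<Sum>i<length (pieces D).
        if pieces D ! i \<in> {PlusOne, MinusOne} \<and> col (i, NW) \<noteq> col (i, NE)
        then crossing_sign D out i else 0)"

text \<open>
  The two strands are in the reference orientation, or both in its reverse, iff the sign is \<open>1\<close>.
  For the shape \<open>Zero\<close> the reference is the orientation of \<open>R\<^bsub>p/q\<^esub>\<close>, out at \<open>NW\<close> and in at \<open>SW\<close>;
  for the other shapes both strands run upwards.
\<close>

definition reference_sign :: "piece \<Rightarrow> (corner \<Rightarrow> bool) \<Rightarrow> int" where
  "reference_sign x b = (if (if x = Zero then b NW \<noteq> b SW else b NW = b NE) then 1 else -1)"

text \<open>
  The values that a marking of a tangle can take at its ends, if its ends are connected like the
  corners of the piece \<open>x\<close>.
\<close>

definition alternates :: "bool \<Rightarrow> piece \<Rightarrow> (corner \<Rightarrow> bool) \<Rightarrow> bool" where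
  "alternates w x b \<longleftrightarrow> (\<forall>c. b (other_end x c) \<longleftrightarrow> b c \<noteq> w)"

lemma corner_all: "(\<forall>c. P c) \<longleftrightarrow> P NW \<and> P NE \<and> P SW \<and> P SE"
  by (metis corner.exhaust)

lemma corner_ex: "(\<exists>c. P c) \<longleftrightarrow> P NW \<or> P NE \<or> P SW \<or> P SE"
  by (metis corner.exhaust)

lemma alternates_simps [simp]:
  "alternates w Zero b \<longleftrightarrow> (b NE \<longleftrightarrow> b NW \<noteq> w) \<and> (b SE \<longleftrightarrow> b SW \<noteq> w)"
  "alternates w Infty b \<longleftrightarrow> (b SW \<longleftrightarrow> b NW \<noteq> w) \<and> (b SE \<longleftrightarrow> b NE \<noteq> w)"
  "alternates w PlusOne b \<longleftrightarrow> (b SE \<longleftrightarrow> b NW \<noteq> w) \<and> (b SW \<longleftrightarrow> b NE \<noteq> w)"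
  by (auto simp: alternates_def corner_all)

text \<open>
  Here \<open>x\<close> is \<open>Zero\<close>, \<open>Infty\<close> or \<open>PlusOne\<close> for an \<open>H\<close>-, \<open>V\<close>- or \<open>D\<close>-tangle.  Markings express the
  connectivity without any reference to paths: \<open>pairing\<close> says which ends are joined by strands,
  \<open>reaches_end\<close> that there are no closed components, and \<open>extension\<close> that there are no further
  connections.  In \<open>writhe\<close>, the colouring is required to tell the two strands apart.
\<close>

locale tangle_of_shape =
  fixes T :: tangle and x :: piece and l :: int
  assumes ends_in: "ends T c \<in> endpoints T"
    and joins_in: "joins T \<subseteq> endpoints T \<times> endpoints T"
    and pairing: "marking w T m \<Longrightarrow> alternates w x (\<lambda>c. m (ends T c))"
    and reaches_end: "marking False T m \<Longrightarrow> a \<in> endpoints T \<Longrightarrow> \<exists>c. m a = m (ends T c)"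
    and extension: "alternates w x b \<Longrightarrow> \<exists>m. marking w T m \<and> (\<forall>c. m (ends T c) = b c)"
    and writhe: "marking False T col \<Longrightarrow> marking True T out \<Longrightarrow>
      \<exists>c. col (ends T c) \<noteq> col (ends T NW) \<Longrightarrow>
      mixed_writhe T col out = reference_sign x (\<lambda>c. out (ends T c)) * l"

lemma tangle_of_shape_elementary:
  "tangle_of_shape (elementary y) (if y = MinusOne then PlusOne else y)
     (if y = PlusOne then 1 else if y = MinusOne then -1 else 0)"
    (is "tangle_of_shape _ ?x ?l")
proof -
  have marking: "marking w (elementary y) m \<longleftrightarrow> alternates w ?x (\<lambda>c. m (ends (elementary y) c))"
    for w m
    by (cases y) (simp_all add: marking_def elementary_def corner_all, auto)
  show ?thesis
  proof
    fix b w
    assume "alternates w ?x b"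
    then have "marking w (elementary y) (\<lambda>a. b (snd a))"
      unfolding marking by (simp add: elementary_def)
    then show "\<exists>m. marking w (elementary y) m \<and> (\<forall>c. m (ends (elementary y) c) = b c)"
      by (intro exI [of _ "\<lambda>a. b (snd a)"]) (simp add: elementary_def)
  next
    fix col out
    assume "marking False (elementary y) col" "marking True (elementary y) out"
      and "\<exists>c. col (ends (elementary y) c) \<noteq> col (ends (elementary y) NW)"
    then show "mixed_writhe (elementary y) col out =
        reference_sign ?x (\<lambda>c. out (ends (elementary y) c)) * ?l"
      unfolding marking
      by (cases y; simp add: mixed_writhe_def elementary_def corner_ex reference_sign_def
          crossing_sign_def over_direction_def under_direction_def direction_def left_to_right_def)
  qed (use marking in \<open>auto simp: elementary_def endpoints_def\<close>)
qed

section \<open>Stacking two tangles\<close>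

fun flip_v :: "corner \<Rightarrow> corner" where
  "flip_v NW = SW" | "flip_v SW = NW" | "flip_v NE = SE" | "flip_v SE = NE"

fun flip_h :: "corner \<Rightarrow> corner" where
  "flip_h NW = NE" | "flip_h NE = NW" | "flip_h SW = SE" | "flip_h SE = SW"

text \<open>
  The common form of \<open>above\<close> and \<open>beside\<close>: the ends of \<open>S\<close> in \<open>J\<close> are joined to the ends of \<open>T\<close> that
  the reflection \<open>r\<close> assigns to them.
\<close>

definition glue :: "corner set \<Rightarrow> (corner \<Rightarrow> corner) \<Rightarrow> tangle \<Rightarrow> tangle \<Rightarrow> tangle" where
  "glue J r S T =
     (let sh = shift (length (pieces S))
      in \<lparr>pieces = pieces S @ pieces T,
          joins = joins S \<union> map_prod sh sh ` joins T \<union> (\<lambda>c. (ends S c, sh (ends T (r c)))) ` J,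
          ends = (\<lambda>c. if c \<in> J then sh (ends T c) else ends S c)\<rparr>)"

lemma above_eq_glue: "above S T = glue {SW, SE} flip_v S T"
proof -
  have "c \<in> {NW, NE} \<longleftrightarrow> \<not> c \<in> {SW, SE}" for c by (cases c) auto
  then show ?thesis by (simp add: above_def glue_def Let_def fun_eq_iff del: insert_iff)
qed

lemma beside_eq_glue: "beside S T = glue {NE, SE} flip_h S T"
proof -
  have "c \<in> {NW, SW} \<longleftrightarrow> \<not> c \<in> {NE, SE}" for c by (cases c) auto
  then show ?thesis by (simp add: beside_def glue_def Let_def fun_eq_iff del: insert_iff)
qed

lemma ends_glue:
  "ends (glue J r S T) c =
    (if c \<in> J then shift (length (pieces S)) (ends T c) else ends S c)"
  by (simp add: glue_def Let_def)

lemma all_less_add: "(\<forall>i<m + n. P i) \<longleftrightarrow> (\<forall>i<m. P i) \<and> (\<forall>i<n. P (m + i :: nat))"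
  by (metis add_less_cancel_left le_add_diff_inverse linorder_not_less trans_less_add1)

lemma marking_glue:
  "marking w (glue J r S T) m \<longleftrightarrow>
     marking w S m \<and> marking w T (m \<circ> shift (length (pieces S))) \<and>
     (\<forall>c\<in>J. m (shift (length (pieces S)) (ends T (r c))) \<longleftrightarrow> m (ends S c) \<noteq> w)"
  unfolding marking_def glue_def Let_def
  by (auto simp: all_less_add nth_append shift_def ball_Un)

lemma mixed_writhe_glue:
  "mixed_writhe (glue J r S T) col out =
     mixed_writhe S col out +
     mixed_writhe T (col \<circ> shift (length (pieces S))) (out \<circ> shift (length (pieces S)))"
proof -
  let ?m = "length (pieces S)" and ?n = "length (pieces T)"
  have "(\<Sum>i<?m + ?n. f i) = (\<Sum>i<?m. f i) + (\<Sum>i<?n. f (?m + i))" for f :: "nat \<Rightarrow> int"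
    using sum.atLeastLessThan_concat [of 0 ?m "?m + ?n" f] sum.shift_bounds_nat_ivl [of f 0 ?m ?n]
    by (simp add: lessThan_atLeast0 add.commute)
  moreover have "crossing_sign (glue J r S T) out i = crossing_sign S out i" if "i < ?m" for i
    using that by (simp add: glue_def Let_def nth_append crossing_sign_def over_direction_def
        under_direction_def)
  moreover have "crossing_sign (glue J r S T) out (?m + i) =
      crossing_sign T (out \<circ> shift ?m) i" for i
    by (simp add: glue_def Let_def nth_append crossing_sign_def over_direction_def
        under_direction_def direction_def shift_def)
  moreover have "pieces (glue J r S T) = pieces S @ pieces T"
    by (simp add: glue_def Let_def)
  ultimately show ?thesis
    unfolding mixed_writhe_def
    by (auto simp: nth_append shift_def intro!: arg_cong2 [of _ _ _ _ "(+)"] sum.cong)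
qed


lemma endpoints_glue:
  "endpoints (glue J r S T) = endpoints S \<union> shift (length (pieces S)) ` endpoints T"
proof -
  have "(i, c) \<in> endpoints (glue J r S T) \<longleftrightarrow>
      (i, c) \<in> endpoints S \<or> (i, c) \<in> shift (length (pieces S)) ` endpoints T" for i c
  proof (cases "i < length (pieces S)")
    case True
    then show ?thesis by (auto simp: endpoints_def glue_def Let_def shift_def)
  next
    case False
    then have "(i, c) = shift (length (pieces S)) (i - length (pieces S), c)"
      by (simp add: shift_def)
    moreover have "inj (shift (length (pieces S)))"
      by (auto simp: inj_def shift_def)
    ultimately have "(i, c) \<in> shift (length (pieces S)) ` endpoints T \<longleftrightarrow>
        (i - length (pieces S), c) \<in> endpoints T"
      by (metis inj_image_mem_iff)
    then show ?thesis
      using False by (auto simp: endpoints_def glue_def Let_def)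
  qed
  then show ?thesis by auto
qed

text \<open>
  For \<open>above\<close>, \<open>H\<close> and \<open>V\<close> are the horizontal and the vertical shape; for \<open>beside\<close> they are
  exchanged.
  Both strands of \<open>T\<close> run from \<open>S\<close> to the new ends.  If the glued ends of \<open>S\<close> lie on different
  strands, the crossing sums add up, as the reference orientations of \<open>S\<close> and \<open>T\<close> match.  Otherwise
  \<open>T\<close> only prolongs one strand of \<open>S\<close>, so its crossings do not count; if it exchanges the two ends
  of that strand, the reference orientation of the result reverses it, whence the sign.
  The shape \<open>H\<close> is not possible for \<open>T\<close>, since it could close up a strand of \<open>S\<close>.
\<close>

lemma tangle_of_shape_glue:
  assumes S: "tangle_of_shape S x k" and T: "tangle_of_shape T y l"
    and J: "(J, r, H, V) \<in> {({SW, SE}, flip_v, Zero, Infty), ({NE, SE}, flip_h, Infty, Zero)}"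
    and x: "x \<in> {Zero, Infty, PlusOne}" and y: "y \<in> {V, PlusOne}"
  shows "tangle_of_shape (glue J r S T)
    (if x = H then H else if x = y then V else PlusOne)
    (if x = H then if y = V then k else - k else k + l)"
    (is "tangle_of_shape ?G ?z ?n")
proof -
  interpret S: tangle_of_shape S x k by fact
  interpret T: tangle_of_shape T y l by fact
  let ?sh = "shift (length (pieces S))"
  have mS: "marking w S m" and mT: "marking w T (m \<circ> ?sh)"
    and mJ: "c \<in> J \<Longrightarrow> m (?sh (ends T (r c))) \<longleftrightarrow> m (ends S c) \<noteq> w"
    if "marking w ?G m" for w m c
    using that by (auto simp: marking_glue)
  have pS: "alternates w x (\<lambda>c. m (ends S c))"
    and pT: "alternates w y (\<lambda>c. m (?sh (ends T c)))"
    and pJ: "\<forall>c\<in>J. m (?sh (ends T (r c))) \<longleftrightarrow> m (ends S c) \<noteq> w" if "marking w ?G m" for w m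
    using S.pairing [OF mS [OF that]] T.pairing [OF mT [OF that]] mJ [OF that] by auto
  consider (v) "J = {SW, SE}" "r = flip_v" "H = Zero" "V = Infty"
    | (h) "J = {NE, SE}" "r = flip_h" "H = Infty" "V = Zero"
    using J by auto
  note J_cases = this
  have xy: "x = H \<or> x = V \<or> x = PlusOne" "y = V \<or> y = PlusOne"
    using J x y by auto
  show ?thesis
  proof
    show "ends ?G c \<in> endpoints ?G" for c
      using S.ends_in T.ends_in by (auto simp: ends_glue endpoints_glue)
    show "joins ?G \<subseteq> endpoints ?G \<times> endpoints ?G"
      using S.joins_in T.joins_in S.ends_in T.ends_in
      unfolding endpoints_glue by (auto simp: glue_def Let_def)
  next
    fix w m
    assume m: "marking w ?G m"
    show "alternates w ?z (\<lambda>c. m (ends ?G c))"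
      using J_cases xy pS [OF m] pT [OF m] pJ [OF m]
      by cases (cases w; elim disjE; auto simp: ends_glue)+
  next
    fix m a
    assume m: "marking False ?G m" and a: "a \<in> endpoints ?G"
    then have "(\<exists>c. m a = m (ends S c)) \<or> (\<exists>c. m a = m (?sh (ends T c)))"
      using S.reaches_end [OF mS [OF m]] T.reaches_end [OF mT [OF m]]
      unfolding endpoints_glue by (metis Un_iff comp_apply imageE)
    moreover have "\<exists>c. m (ends S d) = m (ends ?G c)" for d
      using J_cases xy(2) pT [OF m] pJ [OF m] unfolding corner_ex
      by cases (elim disjE; cases d; simp add: ends_glue)+
    moreover have "\<exists>c. m (?sh (ends T d)) = m (ends ?G c)" for d
      using J_cases xy(2) pT [OF m] pJ [OF m] unfolding corner_ex
      by cases (elim disjE; cases d; simp add: ends_glue)+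
    ultimately show "\<exists>c. m a = m (ends ?G c)" by metis
  next
    fix b :: "corner \<Rightarrow> bool" and w
    assume b: "alternates w ?z b"
    \<comment> \<open>Transport the prescribed values along the strands of \<open>T\<close> to the glued ends.\<close>
    define bT where "bT c = (if c \<in> J then b c else b (other_end y c) \<noteq> w)" for c
    define bS where "bS c = (if c \<in> J then bT (r c) \<noteq> w else b c)" for c
    have "alternates w x bS"
      using J_cases xy b
      by cases (cases w; elim disjE; simp add: bS_def bT_def)+
    then obtain mS where mS: "marking w S mS" "mS (ends S c) = bS c" for c
      using S.extension by blast
    have "alternates w y bT"
      using J_cases xy b
      by cases (cases w; elim disjE; simp add: bT_def)+
    then obtain mT where mT: "marking w T mT" "mT (ends T c) = bT c" for c
      using T.extension by blast
    define m where "m a = (if a \<in> endpoints S then mS a else mT (fst a - length (pieces S), snd a))"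
      for a
    have m_sh: "m (?sh a) = mT a" for a
      by (simp add: m_def shift_def endpoints_def)
    have "marking w S m"
      using mS(1) S.joins_in by (fastforce simp: marking_def m_def endpoints_def)
    moreover have "m \<circ> ?sh = mT" by (simp add: fun_eq_iff m_sh)
    moreover have m_S: "m (ends S c) = bS c" for c
      using S.ends_in by (simp add: m_def mS)
    moreover have "m (?sh (ends T (r c))) \<longleftrightarrow> m (ends S c) \<noteq> w" if "c \<in> J" for c
      using that by (auto simp: m_sh m_S mT bS_def)
    ultimately have "marking w ?G m"
      using mT(1) by (simp add: marking_glue)
    moreover have "m (ends ?G c) = b c" for c
      by (simp add: ends_glue m_sh m_S mT) (simp add: bS_def bT_def)
    ultimately show "\<exists>m. marking w ?G m \<and> (\<forall>c. m (ends ?G c) = b c)" by blast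
  next
    fix col out
    assume col: "marking False ?G col" and out: "marking True ?G out"
      and ne: "\<exists>c. col (ends ?G c) \<noteq> col (ends ?G NW)"
    note pcol = pS [OF col] pT [OF col] pJ [OF col]
    note pout = pS [OF out] pT [OF out] pJ [OF out]
    have "\<exists>c. col (ends S c) \<noteq> col (ends S NW)"
      using J_cases xy pcol ne unfolding corner_ex
      by cases (elim disjE; simp add: ends_glue)+
    then have wS: "mixed_writhe S col out = reference_sign x (\<lambda>c. out (ends S c)) * k"
      using S.writhe [OF mS [OF col] mS [OF out]] by blast
    \<comment> \<open>If \<open>x = H\<close>, all of \<open>T\<close> belongs to a single strand and hence has only one colour.\<close>
    have wT: "mixed_writhe T (col \<circ> ?sh) (out \<circ> ?sh) =
        (if x = H then 0 else reference_sign y (\<lambda>c. out (?sh (ends T c))) * l)"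
    proof (cases "x = H")
      case True
      have eq: "\<forall>c. col (?sh (ends T c)) = col (?sh (ends T NW))"
        using J_cases True xy(2) pcol unfolding corner_all
        by cases (elim disjE; simp)+
      have "col (?sh a) = col (?sh (ends T NW))" if "a \<in> endpoints T" for a
        using T.reaches_end [OF mT [OF col] that] eq by auto
      then have "mixed_writhe T (col \<circ> ?sh) (out \<circ> ?sh) = 0"
        by (auto simp: mixed_writhe_def endpoints_def intro!: sum.neutral)
      then show ?thesis using True by simp
    next
      case False
      have "\<exists>c. col (?sh (ends T c)) \<noteq> col (?sh (ends T NW))"
        using J_cases False xy pcol ne unfolding corner_ex
        by cases (elim disjE; simp add: ends_glue)+
      then show ?thesis
        using False T.writhe [OF mT [OF col] mT [OF out]] by auto
    qed
    have sum: "mixed_writhe ?G col out =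
        reference_sign x (\<lambda>c. out (ends S c)) * k +
        (if x = H then 0 else reference_sign y (\<lambda>c. out (?sh (ends T c))) * l)"
      by (simp add: mixed_writhe_glue wS wT)
    show "mixed_writhe ?G col out = reference_sign ?z (\<lambda>c. out (ends ?G c)) * ?n"
      unfolding sum using J_cases xy pout
      by cases (elim disjE; auto simp: reference_sign_def ends_glue algebra_simps)+
  qed
qed


section \<open>Components and linking numbers of closures\<close>

lemma equiv_same_strand: "equiv (endpoints D) (same_strand D)"
proof (rule equivI)
  let ?R = "arcs D \<union> (arcs D)\<inverse>"
  have "sym (?R\<^sup>*)"
    by (rule sym_rtrancl) (auto simp: sym_def)
  then show "sym (same_strand D)"
    by (auto simp: same_strand_def sym_def)
  show "trans (same_strand D)"
    by (auto simp: same_strand_def trans_def intro: rtrancl_trans)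
qed (auto simp: same_strand_def refl_on_def)

lemma arcs_same_strand:
  assumes "joins D \<subseteq> endpoints D \<times> endpoints D" "(a, b) \<in> arcs D"
  shows "(a, b) \<in> same_strand D"
  using assms by (auto simp: same_strand_def arcs_def endpoints_def)

lemma marking_same_strand:
  assumes "marking False D m" "(a, b) \<in> same_strand D"
  shows "m a = m b"
proof -
  have arc: "m x = m y" if "(x, y) \<in> arcs D" for x y
    using that assms(1) by (auto simp: arcs_def marking_def)
  have "(a, b) \<in> (arcs D \<union> (arcs D)\<inverse>)\<^sup>*"
    using assms(2) by (simp add: same_strand_def)
  then show ?thesis
    by (induction rule: rtrancl_induct) (auto dest: arc)
qed

text \<open>
  Being connected to \<open>a\<close> is a colouring.  Applied to it, \<open>pairing\<close> and \<open>reaches_end\<close> yield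
  statements about connectivity.
\<close>

lemma marking_strand:
  assumes D: "joins D \<subseteq> endpoints D \<times> endpoints D"
  shows "marking False D (\<lambda>b. (a, b) \<in> same_strand D)"
proof -
  have "(a, b) \<in> same_strand D \<longleftrightarrow> (a, c) \<in> same_strand D" if "(b, c) \<in> arcs D" for b c
    using equiv_same_strand arcs_same_strand [OF D that]
    by (meson equivE symE transE)
  then show ?thesis
    unfolding marking_def arcs_def by blast
qed

text \<open>
  Since the two components exhaust the endpoints, the colouring by membership in \<open>A\<close> also
  determines membership in \<open>B\<close>.
\<close>

lemma linking_number_eq_mixed_writhe:
  assumes D: "joins D \<subseteq> endpoints D \<times> endpoints D"
    and AB: "components D = {A, B}" "A \<noteq> B"
  defines "col \<equiv> \<lambda>a. a \<in> A"
  shows "marking False D col"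
    and "\<exists>a\<in>endpoints D. \<exists>b\<in>endpoints D. col a \<noteq> col b"
    and "linking_number D out A B = of_int (mixed_writhe D col out) / 2"
proof -
  have eq: "equiv (endpoints D) (same_strand D)" by (rule equiv_same_strand)
  have quot: "A \<in> endpoints D // same_strand D" "B \<in> endpoints D // same_strand D"
    using AB by (auto simp: components_def)
  then obtain a where "A = same_strand D `` {a}" by (auto elim: quotientE)
  then have "col = (\<lambda>b. (a, b) \<in> same_strand D)" by (auto simp: col_def)
  then show "marking False D col"
    using marking_strand [OF D] by simp
  have "A \<inter> B = {}"
    using quotient_disj [OF eq quot] AB(2) by blast
  moreover have "A \<union> B = endpoints D"
    using Union_quotient [OF eq] AB(1) by (simp add: components_def)
  ultimately have B: "b \<in> B \<longleftrightarrow> \<not> col b" if "b \<in> endpoints D" for b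
    using that by (auto simp: col_def)
  have "A \<noteq> {}" "B \<noteq> {}"
    using in_quotient_imp_non_empty [OF eq] quot by auto
  then show "\<exists>a\<in>endpoints D. \<exists>b\<in>endpoints D. col a \<noteq> col b"
    using \<open>A \<inter> B = {}\<close> \<open>A \<union> B = endpoints D\<close> unfolding col_def by blast
  have "crossings_between D A B =
      {i \<in> {..<length (pieces D)}. pieces D ! i \<in> {PlusOne, MinusOne} \<and> col (i, NW) \<noteq> col (i, NE)}"
    using B by (auto simp: crossings_between_def endpoints_def col_def)
  then show "linking_number D out A B = of_int (mixed_writhe D col out) / 2"
    by (simp only: linking_number_def mixed_writhe_def sum.inter_filter finite_lessThan of_int_sum
        if_distrib [of of_int] of_int_0)
qed

text \<open>
  The closing arcs \<open>K\<close> carry no crossings.  If the ends all had the same colour, then so would all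
  endpoints of \<open>T\<close>, and there would be only one component; therefore the two strands of \<open>T\<close> lie on
  different components.
\<close>

lemma (in tangle_of_shape) linking_number_closure:
  assumes pieces: "pieces D = pieces T"
    and joins: "joins D = joins T \<union> K" "K \<subseteq> range (ends T) \<times> range (ends T)"
    and AB: "components D = {A, B}" "A \<noteq> B"
    and out: "orientation D out"
  shows "linking_number D out A B = of_int (reference_sign x (\<lambda>c. out (ends T c)) * l) / 2"
proof -
  define col where "col a \<longleftrightarrow> a \<in> A" for a
  have endpoints: "endpoints D = endpoints T"
    by (simp add: endpoints_def pieces)
  have D: "joins D \<subseteq> endpoints D \<times> endpoints D"
    using joins joins_in ends_in unfolding endpoints by blast
  note lk = linking_number_eq_mixed_writhe [OF D AB, folded col_def]
  have T: "marking w T m" if "marking w D m" for w m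
    using that pieces joins by (auto simp: marking_def)
  have "\<exists>c. col (ends T c) \<noteq> col (ends T NW)"
    using lk(2) reaches_end [OF T [OF lk(1)]] unfolding endpoints by metis
  moreover have "crossing_sign D out = crossing_sign T out"
    by (simp add: fun_eq_iff crossing_sign_def over_direction_def under_direction_def pieces)
  then have "mixed_writhe D col out = mixed_writhe T col out"
    by (simp add: mixed_writhe_def pieces cong: if_cong)
  ultimately show ?thesis
    using lk(3) writhe [OF T [OF lk(1)] T] out by (simp add: orientation_iff_marking)
qed


section \<open>Rational tangles\<close>

definition shape :: "int \<Rightarrow> int \<Rightarrow> piece" where
  "shape p q = (if even p then Zero else if even q then Infty else PlusOne)"

lemma add_frac_frac_of: "add_frac (frac_of p q) (of_int k) = frac_of (p + k * q) q"
  by (simp add: frac_of_def field_simps)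

lemma recip_frac_of: "coprime p q \<Longrightarrow> recip (frac_of p q) = frac_of q p"
  by (auto simp: frac_of_def)

text \<open>
  A fraction determines its reduced numerator and denominator up to a common sign, which affects
  neither \<open>shape\<close> nor \<open>frac_linking\<close>.
\<close>

lemma frac_of_eq_iff:
  assumes "coprime p q" "coprime p' q'"
  shows "frac_of p q = frac_of p' q' \<longleftrightarrow> p' = p \<and> q' = q \<or> p' = - p \<and> q' = - q"
proof (cases "q = 0 \<or> q' = 0")
  case True
  then show ?thesis using assms by (auto simp: frac_of_def)
next
  case False
  show ?thesis
  proof
    assume "frac_of p q = frac_of p' q'"
    then have "(of_int (p * q') :: rat) = of_int (p' * q)"
      using False by (simp add: frac_of_def field_simps)
    then have *: "p * q' = p' * q" by (simp only: of_int_eq_iff)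
    then have "\<bar>p\<bar> * \<bar>q'\<bar> = \<bar>p'\<bar> * \<bar>q\<bar>" by (metis abs_mult)
    then have "\<bar>p\<bar> = \<bar>p'\<bar> \<and> \<bar>q'\<bar> = \<bar>q\<bar>"
      using assms coprime_crossproduct_int [of p q p' q'] by (simp add: ac_simps)
    then show "p' = p \<and> q' = q \<or> p' = - p \<and> q' = - q"
      using * False by (auto simp: abs_eq_iff)
  qed (use False in \<open>auto simp: frac_of_def\<close>)
qed

lemma coprime_add_self:
  fixes p q :: int
  assumes "coprime p q"
  shows "coprime (p + q) q" "coprime (p - q) q"
  using assms by (simp_all add: coprime_iff_gcd_eq_1 gcd_diff1)

text \<open>
  Since \<open>p\<close> and \<open>q\<close> are not both even, their parities determine the shape, and hence whether the
  two ends that a twist exchanges belong to the same strand; the cases of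
  \<open>tangle_of_shape_glue\<close> then coincide with the recursion rules of \<open>frac_linking\<close>.
\<close>

lemma has_fraction_imp_tangle_of_shape:
  assumes "has_fraction T F"
  shows "\<exists>p q. coprime p q \<and> F = frac_of p q \<and> tangle_of_shape T (shape p q) (frac_linking p q)"
  using assms
proof induction
  case zero
  have "tangle_of_shape (elementary Zero) (shape 0 1) (frac_linking 0 1)"
    using tangle_of_shape_elementary [of Zero] by (simp add: shape_def frac_linking_def)
  then show ?case
    by (intro exI [of _ 0] exI [of _ 1]) (simp add: frac_of_def)
next
  case (horizontal_plus T F)
  then obtain p q where pq: "coprime p q" "F = frac_of p q"
    and T: "tangle_of_shape T (shape p q) (frac_linking p q)" by blast
  have "tangle_of_shape (beside T (elementary PlusOne)) (shape (p + q) q) (frac_linking (p + q) q)"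
    unfolding beside_eq_glue
    using tangle_of_shape_glue [OF T tangle_of_shape_elementary [of PlusOne],
        of "{NE, SE}" flip_h Infty Zero] pq(1)
    by (auto simp: shape_def frac_linking_add split: if_splits)
  moreover have "add_frac F 1 = frac_of (p + q) q"
    using add_frac_frac_of [of p q 1] pq by simp
  moreover have "coprime (p + q) q"
    using pq coprime_add_self by blast
  ultimately show ?case by blast
next
  case (horizontal_minus T F)
  then obtain p q where pq: "coprime p q" "F = frac_of p q"
    and T: "tangle_of_shape T (shape p q) (frac_linking p q)" by blast
  have "tangle_of_shape (beside T (elementary MinusOne)) (shape (p - q) q) (frac_linking (p - q) q)"
    unfolding beside_eq_glue
    using tangle_of_shape_glue [OF T tangle_of_shape_elementary [of MinusOne],
        of "{NE, SE}" flip_h Infty Zero] pq(1)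
    by (auto simp: shape_def frac_linking_diff split: if_splits)
  moreover have "add_frac F (- 1) = frac_of (p - q) q"
    using add_frac_frac_of [of p q "- 1"] pq by simp
  moreover have "coprime (p - q) q"
    using pq coprime_add_self by blast
  ultimately show ?case by blast
next
  case (vertical_plus T F)
  then obtain p q where pq: "coprime p q" "F = frac_of p q"
    and T: "tangle_of_shape T (shape p q) (frac_linking p q)" by blast
  have "tangle_of_shape (above T (elementary PlusOne)) (shape p (q + p)) (frac_linking p (q + p))"
    unfolding above_eq_glue
    using tangle_of_shape_glue [OF T tangle_of_shape_elementary [of PlusOne],
        of "{SW, SE}" flip_v Zero Infty] frac_linking_add [of q p]
    by (auto simp: shape_def frac_linking_commute split: if_splits)
  moreover have "coprime p (q + p)"
    using pq coprime_add_self [of q p] by (simp add: coprime_commute)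
  moreover from this have "recip (add_frac (recip F) 1) = frac_of p (q + p)"
    using add_frac_frac_of [of q p 1] pq by (simp add: recip_frac_of coprime_commute)
  ultimately show ?case by blast
next
  case (vertical_minus T F)
  then obtain p q where pq: "coprime p q" "F = frac_of p q"
    and T: "tangle_of_shape T (shape p q) (frac_linking p q)" by blast
  have "tangle_of_shape (above T (elementary MinusOne)) (shape p (q - p)) (frac_linking p (q - p))"
    unfolding above_eq_glue
    using tangle_of_shape_glue [OF T tangle_of_shape_elementary [of MinusOne],
        of "{SW, SE}" flip_v Zero Infty] frac_linking_diff [of q p]
    by (auto simp: shape_def frac_linking_commute split: if_splits)
  moreover have "coprime p (q - p)"
    using pq coprime_add_self [of q p] by (simp add: coprime_commute)
  moreover from this have "recip (add_frac (recip F) (- 1)) = frac_of p (q - p)"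
    using add_frac_frac_of [of q p "- 1"] pq by (simp add: recip_frac_of coprime_commute)
  ultimately show ?case by blast
qed

lemma rational_tangle_imp_tangle_of_shape:
  assumes "rational_tangle p q T"
  shows "tangle_of_shape T (shape p q) (frac_linking p q)"
proof -
  obtain p' q' where "coprime p' q'" "frac_of p q = frac_of p' q'"
    and T: "tangle_of_shape T (shape p' q') (frac_linking p' q')"
    using assms has_fraction_imp_tangle_of_shape by (metis rational_tangle_def)
  then have "p' = p \<and> q' = q \<or> p' = - p \<and> q' = - q"
    using assms frac_of_eq_iff by (simp add: rational_tangle_def)
  then show ?thesis
    using T by (auto simp: shape_def frac_linking_uminus)
qed

lemma recip_recip [simp]: "recip (recip F) = F"
  by (cases F) auto

text \<open>
  Exchanging horizontal and vertical twists inverts the fraction.  The start tangle has to be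
  replaced by one with fraction \<open>\<infinity>\<close>, obtained as \<open>0, 1, \<infinity>\<close>: a horizontal twist and then
  a vertical twist of the opposite sign.
\<close>

lemma has_fraction_recip: "has_fraction T F \<Longrightarrow> \<exists>T'. has_fraction T' (recip F)"
proof (induction rule: has_fraction.induct)
  case zero
  have "has_fraction (above (beside (elementary Zero) (elementary PlusOne)) (elementary MinusOne))
      (recip (add_frac (recip (add_frac (Fin 0) 1)) (- 1)))"
    by (intro has_fraction.intros)
  then show ?case by auto
next
  case (horizontal_plus T F)
  then show ?case using vertical_plus by fastforce
next
  case (horizontal_minus T F)
  then show ?case using vertical_minus by fastforce
next
  case (vertical_plus T F)
  then show ?case using horizontal_plus by fastforce
next
  case (vertical_minus T F)
  then show ?case using horizontal_minus by fastforce
qed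

text \<open>
  The tangles whose closures are the links \<open>R\<close> in the formula exist; this is what makes the definite
  description in \<open>lk_R\<close> denote their linking number.
\<close>

lemma rational_tangle_recip_add:
  assumes "rational_tangle p q T" and "k \<in> {0, 1}"
  shows "\<exists>T'. rational_tangle (q + k * p) p T'"
proof -
  have pq: "coprime p q" "has_fraction T (frac_of p q)"
    using assms(1) by (simp_all add: rational_tangle_def)
  obtain T' where T': "has_fraction T' (frac_of q p)"
    using has_fraction_recip [OF pq(2)] recip_frac_of [OF pq(1)] by auto
  have "has_fraction (beside T' (elementary PlusOne)) (frac_of (q + p) p)"
    using horizontal_plus [OF T'] add_frac_frac_of [of q p 1] by simp
  then show ?thesis
    using assms(2) T' pq(1) coprime_add_self [of q p]
    by (auto simp: rational_tangle_def coprime_commute)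
qed

text \<open>
  Every endpoint is connected to an end, hence to \<open>NW\<close> or \<open>SW\<close>; these are not connected to each
  other, because some colouring separates the upper ends from the lower ones and is compatible
  with the closing arcs.
\<close>

lemma (in tangle_of_shape) components_numerator_closure:
  assumes "x = Zero"
  shows "\<exists>A B. components (numerator_closure T) = {A, B} \<and> A \<noteq> B"
proof -
  let ?D = "numerator_closure T"
  let ?R = "same_strand ?D"
  have endpoints: "endpoints ?D = endpoints T"
    by (simp add: endpoints_def numerator_closure_def)
  have D: "joins ?D \<subseteq> endpoints ?D \<times> endpoints ?D"
    using joins_in ends_in unfolding endpoints by (auto simp: numerator_closure_def)
  have T: "marking w T m" if "marking w ?D m" for w m
    using that by (auto simp: marking_def numerator_closure_def)
  have reach: "(a, ends T NW) \<in> ?R \<or> (a, ends T SW) \<in> ?R" if a: "a \<in> endpoints T" for a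
  proof -
    have m: "marking False T (\<lambda>b. (a, b) \<in> ?R)"
      by (intro T marking_strand D)
    have "(a, a) \<in> ?R"
      using a by (simp add: same_strand_def endpoints)
    then obtain c where "(a, ends T c) \<in> ?R"
      using reaches_end [OF m a] by auto
    then show ?thesis
      using pairing [OF m] assms by (cases c) auto
  qed
  let ?A = "?R `` {ends T NW}" and ?B = "?R `` {ends T SW}"
  have "components ?D = {?A, ?B}"
  proof
    show "components ?D \<subseteq> {?A, ?B}"
    proof
      fix C
      assume "C \<in> components ?D"
      then obtain a where "C = ?R `` {a}" "a \<in> endpoints T"
        by (auto simp: components_def endpoints elim: quotientE)
      then show "C \<in> {?A, ?B}"
        using reach equiv_class_eq [OF equiv_same_strand [of ?D]] by blast
    qed
    show "{?A, ?B} \<subseteq> components ?D"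
      using ends_in by (auto simp: components_def endpoints intro: quotientI)
  qed
  moreover have "?A \<noteq> ?B"
  proof
    assume "?A = ?B"
    then have "(ends T NW, ends T SW) \<in> ?R"
      using eq_equiv_class [OF _ equiv_same_strand [of ?D]] ends_in by (simp add: endpoints)
    moreover obtain m where "marking False T m" and m: "m (ends T c) \<longleftrightarrow> c \<in> {NW, NE}" for c
      using extension [of False "\<lambda>c. c \<in> {NW, NE}"] assms by auto
    then have "marking False ?D m"
      by (auto simp: marking_def numerator_closure_def)
    ultimately show False
      using marking_same_strand [of ?D m] m [of NW] m [of SW] by auto
  qed
  ultimately show ?thesis by blast
qed

text \<open>
  All rational \<open>p/q\<close>-tangles give the same value, and \<open>T\<close> shows that there is one.  In the
  orientation of \<open>R\<^bsub>p/q\<^esub>\<close>, which is the reference orientation of the shape \<open>Zero\<close>, the sign is \<open>1\<close>.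
\<close>

lemma lk_R_eq:
  assumes T: "rational_tangle p q T" and p: "even p"
  shows "lk_R p q = of_int (frac_linking p q) / 2"
  unfolding lk_R_def
proof (rule the_equality)
  have lk: "linking_number (numerator_closure T) out A B = of_int (frac_linking p q) / 2"
    if "rational_tangle p q T" "R_orientation T out"
      "components (numerator_closure T) = {A, B}" "A \<noteq> B" for T out A B
  proof -
    interpret tangle_of_shape T "shape p q" "frac_linking p q"
      using that(1) by (rule rational_tangle_imp_tangle_of_shape)
    have "reference_sign (shape p q) (\<lambda>c. out (ends T c)) = 1"
      using that(2) p by (simp add: R_orientation_def reference_sign_def shape_def)
    then show ?thesis
      using linking_number_closure [OF _ _ _ that(3,4),
          of "{(ends T NW, ends T NE), (ends T SW, ends T SE)}" out] that(2)
      by (simp add: numerator_closure_def R_orientation_def)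
  qed
  interpret tangle_of_shape T "shape p q" "frac_linking p q"
    using T by (rule rational_tangle_imp_tangle_of_shape)
  have "shape p q = Zero" using p by (simp add: shape_def)
  then obtain A B where AB: "components (numerator_closure T) = {A, B}" "A \<noteq> B"
    using components_numerator_closure by blast
  obtain out where "marking True T out" and out: "out (ends T c) \<longleftrightarrow> c \<in> {NW, SE}" for c
    using extension [of True "\<lambda>c. c \<in> {NW, SE}"] \<open>shape p q = Zero\<close> by auto
  then have "R_orientation T out"
    by (auto simp: R_orientation_def orientation_iff_marking marking_def numerator_closure_def)
  then show "\<exists>T out A B. rational_tangle p q T \<and> R_orientation T out \<and>
      components (numerator_closure T) = {A, B} \<and> A \<noteq> B \<and>
      of_int (frac_linking p q) / 2 = linking_number (numerator_closure T) out A B"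
    using lk T AB by metis
  show "l = of_int (frac_linking p q) / 2"
    if "\<exists>T out A B. rational_tangle p q T \<and> R_orientation T out \<and>
      components (numerator_closure T) = {A, B} \<and> A \<noteq> B \<and>
      l = linking_number (numerator_closure T) out A B" for l
    using that by (elim exE conjE) (simp add: lk)
qed


section \<open>Montesinos links\<close>

text \<open>
  Tangles without a strand from \<open>NW\<close> to \<open>NE\<close>.  Stacking them keeps all strands running upwards,
  so their crossing sums \<open>l\<close> are additive.
\<close>

definition vertical_tangle :: "tangle \<Rightarrow> int \<Rightarrow> bool" where
  "vertical_tangle T l \<longleftrightarrow> (\<exists>x\<in>{Infty, PlusOne}. tangle_of_shape T x l)"

lemma vertical_tangle_above:
  assumes "vertical_tangle S k" "vertical_tangle T l"
  shows "vertical_tangle (above S T) (k + l)"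
proof -
  obtain x y where x: "x \<in> {Infty, PlusOne}" "tangle_of_shape S x k"
    and y: "y \<in> {Infty, PlusOne}" "tangle_of_shape T y l"
    using assms unfolding vertical_tangle_def by blast
  then have "tangle_of_shape (above S T) (if x = y then Infty else PlusOne) (k + l)"
    using tangle_of_shape_glue [OF x(2) y(2), of "{SW, SE}" flip_v Zero Infty]
    by (auto simp: above_eq_glue)
  then show ?thesis
    unfolding vertical_tangle_def by (metis insertCI)
qed

lemma vertical_tangle_stack:
  "vertical_tangle T l \<Longrightarrow> list_all2 vertical_tangle Us ls \<Longrightarrow>
    vertical_tangle (stack T Us) (l + sum_list ls)"
proof (induction Us arbitrary: T l ls)
  case (Cons U Us)
  then obtain k ks where "ls = k # ks" "vertical_tangle U k" "list_all2 vertical_tangle Us ks"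
    by (auto simp: list_all2_Cons1)
  then show ?case
    using Cons.IH [OF vertical_tangle_above [OF Cons.prems(1)]] by (simp add: add.assoc)
qed simp

lemma half_twists_vertical:
  "\<exists>ls. list_all2 vertical_tangle (half_twists e) ls \<and> sum_list ls = e"
proof (cases "e = 0")
  case True
  have "vertical_tangle (elementary Infty) 0"
    using tangle_of_shape_elementary [of Infty] by (auto simp: vertical_tangle_def)
  then show ?thesis
    using True by (intro exI [of _ "[0]"]) (simp add: half_twists_def)
next
  case False
  have "vertical_tangle (elementary PlusOne) 1" "vertical_tangle (elementary MinusOne) (- 1)"
    using tangle_of_shape_elementary [of PlusOne] tangle_of_shape_elementary [of MinusOne]
    by (auto simp: vertical_tangle_def)
  then show ?thesis
    using False
    by (intro exI [of _ "replicate (nat \<bar>e\<bar>) (sgn e)"])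
      (auto simp: half_twists_def list_all2_conv_all_nth sum_list_replicate)
qed

lemma rational_tangle_vertical:
  assumes "rational_tangle p q T" "\<not> H_tangle T"
  shows "odd p" "vertical_tangle T (frac_linking p q)"
proof -
  interpret tangle_of_shape T "shape p q" "frac_linking p q"
    using assms(1) by (rule rational_tangle_imp_tangle_of_shape)
  have "(ends T NW, ends T NW) \<in> same_strand T"
    using ends_in by (simp add: same_strand_def)
  then show "odd p"
    using pairing [OF marking_strand [OF joins_in], of "ends T NW"] assms(2)
    by (auto simp: shape_def H_tangle_def split: if_splits)
  then show "vertical_tangle T (frac_linking p q)"
    using tangle_of_shape_axioms by (auto simp: vertical_tangle_def shape_def split: if_splits)
qed

theorem theorem5:
  fixes n :: nat and p q eps :: "nat \<Rightarrow> int" and e :: int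
    and T :: "nat \<Rightarrow> tangle" and L :: diagram
    and out :: "endpoint \<Rightarrow> bool" and A B :: "endpoint set"
  assumes "n \<ge> 1"
    and "\<forall>k\<in>{1..n}. coprime (p k) (q k)"
    and "\<forall>k\<in>{1..n}. rational_tangle (p k) (q k) (T k)"
    and "L = montesinos (map T [1..<Suc n]) e"
    and "components L = {A, B}" and "A \<noteq> B"
    and "orientation L out"
    and "\<forall>k\<in>{1..n}. \<not> H_tangle (T k)"
    and "\<forall>k\<in>{1..n}. eps k = (1 - (-1) ^ nat \<bar>q k\<bar>) div 2"
  shows "\<exists>s\<in>{1, -1}. linking_number L out A B =
    s * ((\<Sum>k=1..n. lk_R (q k + eps k * p k) (p k)) + 1 / 2 * of_int (e - (\<Sum>k=1..n. eps k)))"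
proof -
  define l where "l k = frac_linking (p k) (q k)" for k
  have odd: "odd (p k)" and vert: "vertical_tangle (T k) (l k)" if "k \<in> {1..n}" for k
    using rational_tangle_vertical assms(3,8) that unfolding l_def by blast+
  have R: "lk_R (q k + eps k * p k) (p k) = of_int (l k + eps k) / 2" if k: "k \<in> {1..n}" for k
  proof -
    have eps: "eps k = (if even (q k) then 0 else 1)"
      using assms(9) k by (auto simp: even_nat_iff)
    have "eps k \<in> {0, 1}" by (simp add: eps)
    then obtain T' where "rational_tangle (q k + eps k * p k) (p k) T'"
      using rational_tangle_recip_add assms(3) k by blast
    moreover have "even (q k + eps k * p k)"
      using odd [OF k] eps by auto
    moreover have "frac_linking (q k + eps k * p k) (p k) = l k + eps k"
      using odd [OF k] eps frac_linking_add [of "q k" "p k"]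
      by (auto simp: l_def frac_linking_commute)
    ultimately show ?thesis by (simp add: lk_R_eq)
  qed
  have hd_tl: "map T [1..<Suc n] = T 1 # map T [2..<Suc n]"
    using assms(1) by (simp add: upt_conv_Cons numeral_2_eq_2 del: upt_Suc)
  obtain ls where ls: "list_all2 vertical_tangle (half_twists e) ls" "sum_list ls = e"
    using half_twists_vertical by blast
  define S where "S = stack (T 1) (map T [2..<Suc n] @ half_twists e)"
  have "list_all2 vertical_tangle (map T [2..<Suc n]) (map l [2..<Suc n])"
    using vert by (auto simp: list_all2_conv_all_nth nth_upt simp del: upt_Suc)
  then have "vertical_tangle S (l 1 + sum_list (map l [2..<Suc n] @ ls))"
    unfolding S_def using vert [of 1] assms(1) ls(1)
    by (intro vertical_tangle_stack list_all2_appendI) auto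
  moreover have "l 1 + sum_list (map l [2..<Suc n]) = (\<Sum>k=1..n. l k)"
  proof -
    have "l 1 + sum_list (map l [2..<Suc n]) = sum_list (map l [1..<Suc n])"
      using assms(1) by (simp add: upt_conv_Cons numeral_2_eq_2 del: upt_Suc)
    also have "\<dots> = sum l {1..<Suc n}"
      by (simp add: interv_sum_list_conv_sum_set_nat del: upt_Suc)
    finally show ?thesis by (simp add: atLeastLessThanSuc_atLeastAtMost)
  qed
  ultimately have "vertical_tangle S ((\<Sum>k=1..n. l k) + e)"
    using ls(2) by (simp add: add.assoc [symmetric] del: upt_Suc)
  then obtain x where "tangle_of_shape S x ((\<Sum>k=1..n. l k) + e)"
    unfolding vertical_tangle_def by blast
  then interpret tangle_of_shape S x "(\<Sum>k=1..n. l k) + e" .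
  have L: "L = vertical_closure S"
    using assms(4) hd_tl by (simp add: montesinos_def S_def del: upt_Suc)
  define s where "s = reference_sign x (\<lambda>c. out (ends S c))"
  have "linking_number L out A B = of_int (s * ((\<Sum>k=1..n. l k) + e)) / 2"
    unfolding s_def
    by (rule linking_number_closure [OF _ _ _ assms(5-7),
        of "{(ends S SW, ends S NW), (ends S SE, ends S NE)}"])
      (simp_all add: L vertical_closure_def)
  also have "\<dots> = of_int s * ((\<Sum>k=1..n. lk_R (q k + eps k * p k) (p k)) +
      1 / 2 * of_int (e - (\<Sum>k=1..n. eps k)))"
    by (simp add: R sum.distrib add_divide_distrib flip: sum_divide_distrib) (simp add: field_simps)
  finally show ?thesis
    by (auto simp: s_def reference_sign_def split: if_splits)
qed

end
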